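(* Let $A$ be a real $n\times m$ matrix such that $\min_{\mathbf{y}\in\Delta_m}\max_{\mathbf{x}\in\Delta_n}\mathbf{x}^\top A\mathbf{y}$ has a unique optimal solution $(\mathbf{x}^*,\mathbf{y}^* )$. For $0<\eta<1$ let $(\mathbf{x}^t,\mathbf{y}^t)$ be the OMWU iterates with stepsize $\eta$ started at $(\mathbf{x}^1,\mathbf{y}^1)=(\mathbf{x}^0,\mathbf{y}^0)=(\tfrac1n\mathbf{1},\tfrac1m\mathbf{1})$, and put $D_t=D_{KL}((\mathbf{x}^*,\mathbf{y}^* )\|(\mathbf{x}^t,\mathbf{y}^t))$. Let $\eta_0\in(0,1)$ and $c,C>0$ be constants (independent of $\eta$ and $t$) such that for all $0<\eta<\eta_0$ and all $t\ge2$: if $(\mathbf{x}^t,\mathbf{y}^t)$ is not $C\eta^{1/3}$-close, then $D_{t+1}\le D_t-c\eta^3$. For $0<\eta<\eta_0$ let $T=T(\eta)$ be the first time $t\ge2$ at which the KL divergence does not decrease by $c\eta^3$, i.e. the least $t\ge 2$ with $D_{t+1}>D_t-c\eta^3$. Then $$\lim_{\eta\to0}\big\|(\mathbf{x}^*,\mathbf{y}^* )-(\mathbf{x}^{T(\eta)},\mathbf{y}^{T(\eta)})\big\|_1=0 .$$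
   Context: $\Delta_n\subset\mathbb{R}^n$ and $\Delta_m\subset\mathbb{R}^m$ are the probability simplices, and $\mathbf 1$ is the all-ones vector. An optimal solution of the min-max problem is a pair $(\mathbf{x}^*,\mathbf{y}^* )\in\Delta_n\times\Delta_m$ with $\mathbf{x}^\top A\mathbf{y}^*\le \mathbf{x}^{*\top}A\mathbf{y}^*\le\mathbf{x}^{*\top}A\mathbf{y}$ for all $\mathbf{x}\in\Delta_n$, $\mathbf{y}\in\Delta_m$. Optimistic Multiplicative-Weights Update (OMWU) dynamics with stepsize $\eta\in(0,1)$: given $(\mathbf{x}^1,\mathbf{y}^1),(\mathbf{x}^0,\mathbf{y}^0)\in\Delta_n\times\Delta_m$, for $t\ge1$, $$x_i^{t+1}=x_i^t\,\frac{e^{2\eta(A\mathbf{y}^t)_i-\eta(A\mathbf{y}^{t-1})_i}}{\sum_{j=1}^n x_j^t e^{2\eta(A\mathbf{y}^t)_j-\eta(A\mathbf{y}^{t-1})_j}}\ (i\in[n]),\qquad y_i^{t+1}=y_i^t\,\frac{e^{-2\eta(A^\top\mathbf{x}^t)_i+\eta(A^\top\mathbf{x}^{t-1})_i}}{\sum_{j=1}^m y_j^t e^{-2\eta(A^\top\mathbf{x}^t)_j+\eta(A^\top\mathbf{x}^{t-1})_j}}\ (i\in[m]).$$ $D_{KL}((\mathbf{x}^*,\mathbf{y}^* )\|(\mathbf{x},\mathbf{y}))=\sum_i x_i^*\ln(x_i^*/x_i)+\sum_j y_j^*\ln(y_j^*/y_j)$ (terms with $x_i^*=0$ or $y_j^*=0$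 are $0$). The time $T(\eta)$ is finite because $D_t\ge0$ for all $t$. For $\alpha>0$, a point $(\mathbf{x},\mathbf{y})\in\Delta_n\times\Delta_m$ is $\alpha$-close if for each $i\in[n]$, $x_i\le\alpha$ or $|\mathbf{x}^\top A\mathbf{y}-(A\mathbf{y})_i|\le\alpha$, and for each $j\in[m]$, $y_j\le\alpha$ or $|\mathbf{x}^\top A\mathbf{y}-(A^\top\mathbf{x})_j|\le\alpha$. *)

theory Defs
  imports "HOL-Analysis.Analysis"
begin

definition prob_simplex :: "(real ^ 'k) set" where
  "prob_simplex = {x. (\<forall>i. 0 \<le> x $ i) \<and> (\<Sum>i\<in>UNIV. x $ i) = 1}"

definition uniform_vec :: "real ^ 'k" where
  "uniform_vec = (\<chi> i. 1 / real CARD('k))"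

text \<open>The vector \<open>x\<close> is the maximizing player, \<open>y\<close> the minimizing one.\<close>

definition optimal_solution :: "real ^ 'm ^ 'n \<Rightarrow> (real ^ 'n) \<times> (real ^ 'm) \<Rightarrow> bool" where
  "optimal_solution A z \<longleftrightarrow>
     (case z of (xs, ys) \<Rightarrow>
        xs \<in> prob_simplex \<and> ys \<in> prob_simplex \<and>
        (\<forall>x\<in>prob_simplex. \<forall>y\<in>prob_simplex.
           x \<bullet> (A *v ys) \<le> xs \<bullet> (A *v ys) \<and> xs \<bullet> (A *v ys) \<le> xs \<bullet> (A *v y)))"

definition unique_optimal_solution ::
    "real ^ 'm ^ 'n \<Rightarrow> (real ^ 'n) \<times> (real ^ 'm) \<Rightarrow> bool" where
  "unique_optimal_solution A z \<longleftrightarrow>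
     optimal_solution A z \<and> (\<forall>z'. optimal_solution A z' \<longrightarrow> z' = z)"

text \<open>In \<open>omwu_step \<eta> A (x, y) (x', y')\<close> the pair \<open>(x, y)\<close> is the current iterate and
  \<open>(x', y')\<close> the previous one.\<close>

definition omwu_step ::
    "real \<Rightarrow> real ^ 'm ^ 'n \<Rightarrow> (real ^ 'n) \<times> (real ^ 'm) \<Rightarrow> (real ^ 'n) \<times> (real ^ 'm)
       \<Rightarrow> (real ^ 'n) \<times> (real ^ 'm)" where
  "omwu_step \<eta> A z z' =
     (case z of (x, y) \<Rightarrow> case z' of (x', y') \<Rightarrow>
       ((\<chi> i. x $ i * exp (2 * \<eta> * (A *v y) $ i - \<eta> * (A *v y') $ i) /
          (\<Sum>j\<in>UNIV. x $ j * exp (2 * \<eta> * (A *v y) $ j - \<eta> * (A *v y') $ j))),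
        (\<chi> i. y $ i * exp (- 2 * \<eta> * (transpose A *v x) $ i + \<eta> * (transpose A *v x') $ i) /
          (\<Sum>j\<in>UNIV. y $ j *
             exp (- 2 * \<eta> * (transpose A *v x) $ j + \<eta> * (transpose A *v x') $ j)))))"

text \<open>\<open>omwu \<eta> A z0 z1 t\<close> is the iterate with index \<open>t\<close>, given the iterates \<open>z0\<close> and \<open>z1\<close>
  with indices 0 and 1.\<close>

fun omwu ::
    "real \<Rightarrow> real ^ 'm ^ 'n \<Rightarrow> (real ^ 'n) \<times> (real ^ 'm) \<Rightarrow> (real ^ 'n) \<times> (real ^ 'm) \<Rightarrow> nat
       \<Rightarrow> (real ^ 'n) \<times> (real ^ 'm)" where
  "omwu \<eta> A z0 z1 0 = z0"
| "omwu \<eta> A z0 z1 (Suc 0) = z1"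
| "omwu \<eta> A z0 z1 (Suc (Suc t)) =
     omwu_step \<eta> A (omwu \<eta> A z0 z1 (Suc t)) (omwu \<eta> A z0 z1 t)"

definition omwu_unif :: "real \<Rightarrow> real ^ 'm ^ 'n \<Rightarrow> nat \<Rightarrow> (real ^ 'n) \<times> (real ^ 'm)" where
  "omwu_unif \<eta> A = omwu \<eta> A (uniform_vec, uniform_vec) (uniform_vec, uniform_vec)"

text \<open>Terms with zero first argument vanish because of the factor. A zero coordinate of the
  second argument (where the divergence should be infinite) would yield a junk value, but all
  coordinates of OMWU iterates started at the uniform vectors are positive.\<close>

definition KL_div ::
    "(real ^ 'n) \<times> (real ^ 'm) \<Rightarrow> (real ^ 'n) \<times> (real ^ 'm) \<Rightarrow> real" where
  "KL_div z w =
     (\<Sum>i\<in>UNIV. fst z $ i * ln (fst z $ i / fst w $ i)) +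
     (\<Sum>j\<in>UNIV. snd z $ j * ln (snd z $ j / snd w $ j))"

definition alpha_close :: "real ^ 'm ^ 'n \<Rightarrow> real \<Rightarrow> (real ^ 'n) \<times> (real ^ 'm) \<Rightarrow> bool" where
  "alpha_close A \<alpha> z \<longleftrightarrow>
     (case z of (x, y) \<Rightarrow>
       (\<forall>i. x $ i \<le> \<alpha> \<or> \<bar>x \<bullet> (A *v y) - (A *v y) $ i\<bar> \<le> \<alpha>) \<and>
       (\<forall>j. y $ j \<le> \<alpha> \<or> \<bar>x \<bullet> (A *v y) - (transpose A *v x) $ j\<bar> \<le> \<alpha>))"

text \<open>For \<open>c, \<eta> > 0\<close> and \<open>z\<close> in the product of the simplices such a \<open>t\<close> exists, since the
  divergences are nonnegative and so cannot decrease by a fixed amount forever.\<close>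

definition stop_time ::
    "real \<Rightarrow> real ^ 'm ^ 'n \<Rightarrow> (real ^ 'n) \<times> (real ^ 'm) \<Rightarrow> real \<Rightarrow> nat" where
  "stop_time c A z \<eta> =
     (LEAST t. t \<ge> 2 \<and>
        KL_div z (omwu_unif \<eta> A (t + 1)) > KL_div z (omwu_unif \<eta> A t) - c * \<eta> ^ 3)"

definition l1_norm :: "(real ^ 'n) \<times> (real ^ 'm) \<Rightarrow> real" where
  "l1_norm z = (\<Sum>i\<in>UNIV. \<bar>fst z $ i\<bar>) + (\<Sum>j\<in>UNIV. \<bar>snd z $ j\<bar>)"

end

theory Submission
  imports Defs
begin

text \<open>
  At the stopping time the iterate is \<open>C \<eta>\<^sup>1\<^sup>/\<^sup>3\<close>-close, while its divergence is at most the one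
  at time 2, which stays bounded as \<open>\<eta>\<close> tends to 0. Bounded divergence keeps the coordinates in
  the support of the optimal solution away from 0, so every limit point \<open>(x, y)\<close> of the stopped
  iterates makes all actions in the supports of \<open>xs\<close> and \<open>ys\<close> earn exactly the same payoff, which
  must then be the value \<open>v\<close> of the game. By Farkas' lemma a unique solution is strictly
  complementary: actions outside the support of \<open>xs\<close> earn strictly less than \<open>v\<close> against
  \<open>ys\<close>. Hence moving slightly from \<open>ys\<close> towards \<open>y\<close> stays optimal, and uniqueness gives
  \<open>y = ys\<close>; symmetrically \<open>x = xs\<close>.
\<close>

section \<open>Farkas' lemma\<close>

text \<open>Test whether the vector that is -1 at \<open>k\<close> and 0 elsewhere lies in the cone
  generated by the columns of \<open>B\<close> and the unit vectors. If it does, the column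
  coefficients form \<open>y\<close>, the unit vectors acting as slack; if not, the normal of a
  separating hyperplane serves as \<open>x\<close>.\<close>

lemma farkas_alternative:
  fixes B :: "real ^ 'm ^ 'n" and k :: 'n
  shows "(\<exists>y. (\<forall>j. 0 \<le> y $ j) \<and> (\<forall>i. (B *v y) $ i \<le> 0) \<and> (B *v y) $ k < 0) \<or>
    (\<exists>x. (\<forall>i. 0 \<le> x $ i) \<and> 0 < x $ k \<and> (\<forall>j. 0 \<le> (transpose B *v x) $ j))"
proof -
  define S where "S = range (\<lambda>j. column j B) \<union> range (\<lambda>i::'n. axis i (1::real))"
  \<comment> \<open>\<open>K\<close> describes the cone by inequalities, \<open>H\<close> by
    generators. Only \<open>H \<subseteq> K\<close> is required, to read off a witness from
    membership in \<open>H\<close>.\<close>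
  define K where "K = {p. \<exists>y. (\<forall>j. 0 \<le> y $ j) \<and> (\<forall>i. (B *v y) $ i \<le> p $ i)}"
  define H where "H = convex_cone hull S"
  have "finite S" by (simp add: S_def)
  have "convex_cone K"
    unfolding convex_cone_iff
  proof (intro conjI ballI allI impI)
    show "0 \<in> K" unfolding K_def by (auto intro!: exI[of _ 0])
  next
    fix p q assume "p \<in> K" "q \<in> K"
    then obtain y z where "\<forall>j. 0 \<le> y $ j" "\<forall>i. (B *v y) $ i \<le> p $ i"
      "\<forall>j. 0 \<le> z $ j" "\<forall>i. (B *v z) $ i \<le> q $ i"
      unfolding K_def by blast
    then show "p + q \<in> K"
      unfolding K_def by (auto intro!: exI[of _ "y + z"] simp: matrix_vector_right_distrib add_mono)
  next
    fix p and s :: real assume "p \<in> K" "0 \<le> s"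
    then obtain y where "\<forall>j. 0 \<le> y $ j" "\<forall>i. (B *v y) $ i \<le> p $ i"
      unfolding K_def by blast
    with \<open>0 \<le> s\<close> show "s *\<^sub>R p \<in> K"
      unfolding K_def
      by (auto intro!: exI[of _ "s *\<^sub>R y"] mult_left_mono simp: matrix_vector_mult_scaleR)
  qed
  moreover have "S \<subseteq> K"
  proof
    fix p assume "p \<in> S"
    then consider j where "p = column j B" | i where "p = axis i 1"
      unfolding S_def by blast
    then show "p \<in> K"
    proof cases
      case 1
      then show ?thesis unfolding K_def
        by (auto intro!: exI[of _ "axis j 1"] simp: axis_def matrix_vector_mult_basis[unfolded axis_def])
    next
      case 2
      then show ?thesis unfolding K_def by (auto intro!: exI[of _ 0] simp: axis_def)
    qed
  qed
  ultimately have "H \<subseteq> K" unfolding H_def by (simp add: hull_minimal)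
  have "convex_cone H" unfolding H_def by (rule convex_cone_convex_cone_hull)
  show ?thesis
  proof (cases "- axis k 1 \<in> H")
    case True
    with \<open>H \<subseteq> K\<close> obtain y where y: "\<forall>j. 0 \<le> y $ j" "\<forall>i. (B *v y) $ i \<le> (- axis k 1) $ i"
      unfolding K_def by blast
    have "(B *v y) $ i \<le> 0" for i
      using y(2)[rule_format, of i] by (auto simp: axis_def split: if_splits)
    moreover have "(B *v y) $ k < 0"
      using y(2)[rule_format, of k] by (auto simp: axis_def)
    ultimately show ?thesis using y(1) by blast
  next
    case False
    \<comment> \<open>Closedness comes from finite generation; it permits strict separation of a
      point from the cone.\<close>
    have "convex H" "closed H"
      using \<open>convex_cone H\<close> \<open>finite S\<close>
      by (auto simp: H_def convex_convex_cone_hull intro: closed_convex_cone_hull)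
    then obtain a b where ab: "a \<bullet> (- axis k 1) < b" "\<forall>x\<in>H. b < a \<bullet> x"
      using separating_hyperplane_closed_point False by blast
    have "b < 0"
      using ab(2) convex_cone_contains_0[OF \<open>convex_cone H\<close>] by force
    have nonneg: "0 \<le> a \<bullet> s" if "s \<in> S" for s
    proof (rule ccontr)
      assume neg: "\<not> 0 \<le> a \<bullet> s"
      \<comment> \<open>This scaling puts into the cone a point where \<open>a\<close> takes exactly
        the value \<open>b\<close>, against the strict bound in \<open>ab(2)\<close>.\<close>
      with \<open>b < 0\<close> have "0 \<le> b / (a \<bullet> s)" by (simp add: divide_nonpos_neg)
      then have "(b / (a \<bullet> s)) *\<^sub>R s \<in> H"
        using that hull_subset[of S convex_cone] \<open>convex_cone H\<close>
        by (auto simp: H_def intro: convex_cone_scaleR)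
      with ab(2) have "b < a \<bullet> ((b / (a \<bullet> s)) *\<^sub>R s)" by blast
      with neg show False by simp
    qed
    have "0 \<le> a $ i" for i
      using nonneg[of "axis i 1"] by (auto simp: S_def inner_axis)
    moreover have "0 < a $ k"
      using ab(1) \<open>b < 0\<close> by (simp add: inner_axis)
    moreover have "0 \<le> (transpose B *v a) $ j" for j
      using nonneg[of "column j B"]
      by (auto simp: S_def matrix_vector_mult_def transpose_def column_def inner_vec_def mult.commute)
    ultimately show ?thesis by blast
  qed
qed

section \<open>Mixed strategies and saddle points\<close>

lemma normalize_in_prob_simplex:
  fixes y :: "real ^ 'k"
  assumes "\<forall>j. 0 \<le> y $ j" "y $ k \<noteq> 0"
  shows "0 < (\<Sum>j\<in>UNIV. y $ j)" "(1 / (\<Sum>j\<in>UNIV. y $ j)) *\<^sub>R y \<in> prob_simplex"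
proof -
  show pos: "0 < (\<Sum>j\<in>UNIV. y $ j)"
    using assms by (intro sum_pos2[where i = k]) (auto simp: less_le)
  then show "(1 / (\<Sum>j\<in>UNIV. y $ j)) *\<^sub>R y \<in> prob_simplex"
    using assms(1) by (simp add: prob_simplex_def flip: sum_divide_distrib)
qed

lemma inner_prob_simplex_le:
  assumes "x \<in> prob_simplex" "\<And>i. 0 < x $ i \<Longrightarrow> a $ i \<le> v"
  shows "x \<bullet> a \<le> v"
proof -
  have "x \<bullet> a \<le> (\<Sum>i\<in>UNIV. x $ i * v)"
    unfolding inner_vec_def inner_real_def
  proof (rule sum_mono)
    fix i
    have "0 \<le> x $ i" using assms(1) by (simp add: prob_simplex_def)
    then show "x $ i * a $ i \<le> x $ i * v"
      using assms(2)[of i] by (cases "x $ i = 0") (auto intro!: mult_left_mono)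
  qed
  then show ?thesis using assms(1) by (simp add: prob_simplex_def flip: sum_distrib_right)
qed

lemma inner_prob_simplex_ge:
  assumes "x \<in> prob_simplex" "\<And>i. 0 < x $ i \<Longrightarrow> v \<le> a $ i"
  shows "v \<le> x \<bullet> a"
  using inner_prob_simplex_le[of x "- a" "- v"] assms by simp

lemma axis_in_prob_simplex: "axis i 1 \<in> prob_simplex"
  by (simp add: prob_simplex_def axis_def)

lemma inner_matrix_vector_transpose:
  fixes A :: "real ^ 'm ^ 'n"
  shows "x \<bullet> (A *v y) = y \<bullet> (transpose A *v x)"
  by (metis dot_lmul_matrix inner_commute transpose_matrix_vector)

lemma optimal_solution_iff:
  fixes A :: "real ^ 'm ^ 'n"
  shows "optimal_solution A (x, y) \<longleftrightarrow>
    x \<in> prob_simplex \<and> y \<in> prob_simplex \<and>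
    (\<forall>i. (A *v y) $ i \<le> x \<bullet> (A *v y)) \<and> (\<forall>j. x \<bullet> (A *v y) \<le> (transpose A *v x) $ j)"
    (is "?l \<longleftrightarrow> ?r")
proof
  assume ?l
  then have o: "x \<in> prob_simplex" "y \<in> prob_simplex"
    "\<And>x'. x' \<in> prob_simplex \<Longrightarrow> x' \<bullet> (A *v y) \<le> x \<bullet> (A *v y)"
    "\<And>y'. y' \<in> prob_simplex \<Longrightarrow> x \<bullet> (A *v y) \<le> x \<bullet> (A *v y')"
    by (auto simp: optimal_solution_def)
  show ?r
    using o(1,2) o(3)[OF axis_in_prob_simplex] o(4)[OF axis_in_prob_simplex]
    by (simp add: inner_axis' inner_matrix_vector_transpose[of x A "axis _ 1"])
next
  assume ?r
  then show ?l
    using inner_prob_simplex_le[of _ "A *v y"] inner_prob_simplex_ge[of _ _ "transpose A *v x"]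
    by (auto simp: optimal_solution_def inner_matrix_vector_transpose[of x A "_ :: real ^ 'm"])
qed

text \<open>The number \<open>v\<close> need not be known to be the value: averaging the first bound
  over \<open>x\<close> and the second over \<open>y\<close> squeezes the payoff to
  \<open>v\<close>.\<close>

lemma optimal_solutionI:
  fixes A :: "real ^ 'm ^ 'n"
  assumes "x \<in> prob_simplex" "y \<in> prob_simplex"
    "\<And>i. (A *v y) $ i \<le> v" "\<And>j. v \<le> (transpose A *v x) $ j"
  shows "optimal_solution A (x, y)"
proof -
  have "x \<bullet> (A *v y) = v"
    using inner_prob_simplex_le[of x "A *v y" v] inner_prob_simplex_ge[of y v "transpose A *v x"] assms
    by (simp add: inner_matrix_vector_transpose[of x A y] antisym)
  then show ?thesis using assms by (simp add: optimal_solution_iff)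
qed

lemma uminus_matrix_vector_mult:
  fixes A :: "real ^ 'm ^ 'n"
  shows "(- A) *v z = - (A *v z)"
  by (simp add: vec_eq_iff matrix_vector_mult_def sum_negf)

text \<open>The minimizer of \<open>A\<close> is the maximizer of \<open>- transpose A\<close>, so
  one-sided results carry over to the other player.\<close>

lemma unique_optimal_solution_swap:
  fixes A :: "real ^ 'm ^ 'n"
  assumes "unique_optimal_solution A (x, y)"
  shows "unique_optimal_solution (- transpose A) (y, x)"
proof -
  have "transpose (- transpose A) = - A"
    by (simp add: vec_eq_iff transpose_def)
  then have "optimal_solution (- transpose A) (y', x') \<longleftrightarrow> optimal_solution A (x', y')" for x' y'
    unfolding optimal_solution_iff uminus_matrix_vector_mult
      inner_matrix_vector_transpose[of x' A y']
    by (auto simp: uminus_matrix_vector_mult)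
  then show ?thesis using assms by (auto simp: unique_optimal_solution_def)
qed

section \<open>Consequences of uniqueness\<close>

text \<open>Either Farkas alternative, normalized, yields an optimal strategy. A \<open>y\<close>
  has payoff below \<open>v\<close> at \<open>k\<close> and equals \<open>ys\<close> by uniqueness,
  which is the claim; an \<open>x\<close> has positive weight at \<open>k\<close> and equals
  \<open>xs\<close>, which is absurd.\<close>

lemma unique_optimal_strict_complementarity:
  fixes A :: "real ^ 'm ^ 'n"
  assumes uniq: "unique_optimal_solution A (xs, ys)" and "xs $ k = 0"
  shows "(A *v ys) $ k < xs \<bullet> (A *v ys)"
proof -
  define v where "v = xs \<bullet> (A *v ys)"
  \<comment> \<open>Subtracting \<open>v\<close> turns comparisons with the value into sign
    conditions, which survive rescaling a nonnegative vector into the simplex.\<close>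
  define B :: "real ^ 'm ^ 'n" where "B = (\<chi> i j. A $ i $ j - v)"
  have opt: "xs \<in> prob_simplex" "ys \<in> prob_simplex"
    "\<And>i. (A *v ys) $ i \<le> v" "\<And>j. v \<le> (transpose A *v xs) $ j"
    using uniq by (auto simp: unique_optimal_solution_def optimal_solution_iff v_def)
  have By: "(B *v y) $ i = (A *v y) $ i - v * (\<Sum>j\<in>UNIV. y $ j)" for y i
    by (simp add: B_def matrix_vector_mult_def left_diff_distrib sum_subtractf sum_distrib_left)
  have Bx: "(transpose B *v x) $ j = (transpose A *v x) $ j - v * (\<Sum>i\<in>UNIV. x $ i)" for x j
    by (simp add: B_def matrix_vector_mult_def transpose_def left_diff_distrib sum_subtractf
        sum_distrib_left)
  from farkas_alternative[of B k] show ?thesis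
  proof (elim disjE exE conjE)
    fix y assume y: "\<forall>j. 0 \<le> y $ j" "\<forall>i. (B *v y) $ i \<le> 0" "(B *v y) $ k < 0"
    have "\<exists>j. y $ j \<noteq> 0"
    proof (rule ccontr)
      assume "\<not> ?thesis"
      then have "y = 0" by (simp add: vec_eq_iff)
      with y(3) show False by simp
    qed
    then obtain j where j: "y $ j \<noteq> 0" by blast
    define s where "s = (\<Sum>j\<in>UNIV. y $ j)"
    note n = normalize_in_prob_simplex[OF y(1) j, folded s_def]
    have Ay: "(A *v ((1 / s) *\<^sub>R y)) $ i = (A *v y) $ i / s" for i
      by (simp add: matrix_vector_mult_scaleR)
    have "optimal_solution A (xs, (1 / s) *\<^sub>R y)"
      using opt n y(2)
      by (intro optimal_solutionI[where v = v]) (auto simp: Ay By s_def[symmetric] divide_le_eq)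
    then have "(1 / s) *\<^sub>R y = ys"
      using uniq by (simp add: unique_optimal_solution_def)
    moreover have "(A *v ((1 / s) *\<^sub>R y)) $ k < v"
      using n(1) y(3) by (simp add: Ay By s_def[symmetric] divide_less_eq)
    ultimately show ?thesis by (simp add: v_def)
  next
    fix x assume x: "\<forall>i. 0 \<le> x $ i" "0 < x $ k" "\<forall>j. 0 \<le> (transpose B *v x) $ j"
    define s where "s = (\<Sum>j\<in>UNIV. x $ j)"
    have k: "x $ k \<noteq> 0" using x(2) by simp
    note n = normalize_in_prob_simplex[OF x(1) k, folded s_def]
    have Ax: "(transpose A *v ((1 / s) *\<^sub>R x)) $ i = (transpose A *v x) $ i / s" for i
      by (simp only: matrix_vector_mult_scaleR) simp
    have "optimal_solution A ((1 / s) *\<^sub>R x, ys)"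
      using opt n x(3)
      by (intro optimal_solutionI[where v = v])
        (auto simp: Ax Bx s_def[symmetric] le_divide_eq simp del: transpose_matrix_vector)
    then have "xs = (1 / s) *\<^sub>R x"
      using uniq by (simp add: unique_optimal_solution_def)
    with x(2) n(1) \<open>xs $ k = 0\<close> show ?thesis by simp
  qed
qed

text \<open>Rows outside the support of \<open>xs\<close> are not assumed to be bounded against
  \<open>y\<close>, so optimality is shown not for \<open>y\<close> but for a point
  \<open>w s\<close> of the segment near \<open>ys\<close>.\<close>

lemma unique_optimal_column_strategy:
  fixes A :: "real ^ 'm ^ 'n"
  assumes uniq: "unique_optimal_solution A (xs, ys)" and y: "y \<in> prob_simplex"
    and le: "\<And>i. 0 < xs $ i \<Longrightarrow> (A *v y) $ i \<le> xs \<bullet> (A *v ys)"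
  shows "y = ys"
proof -
  define v where "v = xs \<bullet> (A *v ys)"
  have opt: "xs \<in> prob_simplex" "ys \<in> prob_simplex"
    "\<And>i. (A *v ys) $ i \<le> v" "\<And>j. v \<le> (transpose A *v xs) $ j"
    using uniq by (auto simp: unique_optimal_solution_def optimal_solution_iff v_def)
  define w where "w s = (1 - s) *\<^sub>R ys + s *\<^sub>R y" for s :: real
  have Aw: "(A *v w s) $ i = (1 - s) * (A *v ys) $ i + s * (A *v y) $ i" for s i
    by (simp add: w_def matrix_vector_right_distrib matrix_vector_mult_scaleR)
  have "\<forall>\<^sub>F s in at_right 0. (A *v w s) $ i \<le> v" for i
  proof (cases "0 < xs $ i")
    case True
    have "\<forall>\<^sub>F s in at_right (0::real). s \<in> {0<..<1}"
      by (rule eventually_at_right_real) simp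
    then show ?thesis
    proof eventually_elim
      case (elim s)
      then have "(1 - s) * (A *v ys) $ i + s * (A *v y) $ i \<le> (1 - s) * v + s * v"
        using opt(3)[of i] le[OF True, folded v_def] by (intro add_mono mult_left_mono) auto
      then show ?case by (simp add: Aw algebra_simps)
    qed
  next
    case False
    with opt(1) have "xs $ i = 0" by (simp add: prob_simplex_def antisym not_less)
    then have "(A *v ys) $ i < v"
      using unique_optimal_strict_complementarity[OF uniq] by (simp add: v_def)
    \<comment> \<open>Off the support the strict slack at \<open>s = 0\<close> persists for small
      \<open>s\<close> by continuity.\<close>
    moreover have "((\<lambda>s. (A *v w s) $ i) \<longlongrightarrow> (1 - 0) * (A *v ys) $ i + 0 * (A *v y) $ i) (at_right 0)"
      unfolding Aw by (intro tendsto_intros)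
    ultimately have "\<forall>\<^sub>F s in at_right 0. (A *v w s) $ i < v"
      by (auto dest: order_tendstoD(2))
    then show ?thesis by eventually_elim simp
  qed
  then have "\<forall>\<^sub>F s in at_right 0. \<forall>i. (A *v w s) $ i \<le> v"
    by (simp add: eventually_all_finite)
  moreover have "\<forall>\<^sub>F s in at_right (0::real). s \<in> {0<..<1}"
    by (rule eventually_at_right_real) simp
  ultimately have "\<forall>\<^sub>F s in at_right 0. (\<forall>i. (A *v w s) $ i \<le> v) \<and> s \<in> {0<..<1}"
    by eventually_elim simp
  from eventually_happens'[OF _ this] obtain s
    where s: "\<And>i. (A *v w s) $ i \<le> v" "0 < s" "s < 1"
    by auto
  have "w s \<in> prob_simplex"
    using y opt(2) s(2,3)
    by (simp add: w_def prob_simplex_def sum.distrib flip: sum_distrib_left)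
  then have "optimal_solution A (xs, w s)"
    using opt s by (intro optimal_solutionI[where v = v]) auto
  then have "w s = ys" using uniq by (simp add: unique_optimal_solution_def)
  then have "s *\<^sub>R y = s *\<^sub>R ys" by (simp add: w_def algebra_simps)
  with s(2) show ?thesis by simp
qed

lemma unique_optimal_solution_if_equalizing:
  fixes A :: "real ^ 'm ^ 'n"
  assumes uniq: "unique_optimal_solution A (xs, ys)"
    and x: "x \<in> prob_simplex" and y: "y \<in> prob_simplex"
    and eqx: "\<And>i. 0 < xs $ i \<Longrightarrow> (A *v y) $ i = u"
    and eqy: "\<And>j. 0 < ys $ j \<Longrightarrow> (transpose A *v x) $ j = u"
  shows "(x, y) = (xs, ys)"
proof -
  define v where "v = xs \<bullet> (A *v ys)"
  have opt: "xs \<in> prob_simplex" "ys \<in> prob_simplex"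
    "\<And>i. (A *v ys) $ i \<le> v" "\<And>j. v \<le> (transpose A *v xs) $ j"
    using uniq by (auto simp: unique_optimal_solution_def optimal_solution_iff v_def)
  \<comment> \<open>Together with the next two bounds: v <= xs A y <= u and u <= x A ys <=
    v.\<close>
  have "v \<le> y \<bullet> (transpose A *v xs)" "x \<bullet> (A *v ys) \<le> v"
    using opt x y by (auto intro: inner_prob_simplex_le inner_prob_simplex_ge)
  moreover have "xs \<bullet> (A *v y) \<le> u" "u \<le> ys \<bullet> (transpose A *v x)"
    using opt eqx eqy by (auto intro: inner_prob_simplex_le inner_prob_simplex_ge)
  ultimately have "u = v"
    by (simp add: inner_matrix_vector_transpose[of xs A y] inner_matrix_vector_transpose[of x A ys])
  have "y = ys"
    using unique_optimal_column_strategy[OF uniq y] eqx \<open>u = v\<close> by (simp add: v_def)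
  moreover have "x = xs"
    \<comment> \<open>In the swapped game the value is \<open>- v\<close> and \<open>x\<close> plays
      the minimizing side.\<close>
    using unique_optimal_column_strategy[OF unique_optimal_solution_swap[OF uniq] x] eqy \<open>u = v\<close>
    by (simp add: v_def uminus_matrix_vector_mult inner_matrix_vector_transpose[of xs A ys])
  ultimately show ?thesis by simp
qed

section \<open>Compactness and a continuous measure of closeness\<close>

lemma compact_prob_simplex: "compact (prob_simplex :: (real ^ 'k) set)"
proof -
  have "x $ i \<le> 1" if "\<forall>i. 0 \<le> x $ i" "(\<Sum>i\<in>UNIV. x $ i) = 1" for x :: "real ^ 'k" and i
    using that member_le_sum[of i UNIV "\<lambda>i. x $ i"] by simp
  then have eq: "prob_simplex =
      cbox 0 1 \<inter> {x :: real ^ 'k. (\<forall>i. 0 \<le> x $ i) \<and> (\<Sum>i\<in>UNIV. x $ i) = 1}"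
    by (auto simp: prob_simplex_def mem_box_cart)
  show ?thesis
    unfolding eq
    by (intro compact_Int_closed compact_cbox closed_Collect_conj closed_Collect_all
        closed_Collect_le closed_Collect_eq continuous_intros)
qed

text \<open>A continuous function whose zeros in the product of the simplices are the points that are \<open>\<alpha>\<close>-close for every
  \<open>\<alpha> > 0\<close>.\<close>

definition closeness_gap :: "real ^ 'm ^ 'n \<Rightarrow> (real ^ 'n) \<times> (real ^ 'm) \<Rightarrow> real" where
  "closeness_gap A z =
     (\<Sum>i\<in>UNIV. min (fst z $ i) \<bar>fst z \<bullet> (A *v snd z) - (A *v snd z) $ i\<bar>) +
     (\<Sum>j\<in>UNIV. min (snd z $ j) \<bar>fst z \<bullet> (A *v snd z) - (transpose A *v fst z) $ j\<bar>)"

text \<open>Each minimum is at most \<open>\<alpha>\<close> because one of its arguments is. Hence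
  \<open>\<alpha>\<close> tending to 0 forces the gap to 0.\<close>

lemma closeness_gap_le:
  fixes A :: "real ^ 'm ^ 'n"
  assumes "alpha_close A \<alpha> z"
  shows "closeness_gap A z \<le> (real CARD('n) + real CARD('m)) * \<alpha>"
proof -
  have "(\<Sum>i\<in>UNIV. min (fst z $ i) \<bar>fst z \<bullet> (A *v snd z) - (A *v snd z) $ i\<bar>) \<le> real CARD('n) * \<alpha>"
    using assms by (intro sum_bounded_above) (auto simp: alpha_close_def min_le_iff_disj split: prod.splits)
  moreover have "(\<Sum>j\<in>UNIV. min (snd z $ j) \<bar>fst z \<bullet> (A *v snd z) - (transpose A *v fst z) $ j\<bar>)
      \<le> real CARD('m) * \<alpha>"
    using assms by (intro sum_bounded_above) (auto simp: alpha_close_def min_le_iff_disj split: prod.splits)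
  ultimately show ?thesis by (simp add: closeness_gap_def distrib_right)
qed

lemma continuous_on_closeness_gap: "continuous_on S (closeness_gap A)"
  unfolding closeness_gap_def matrix_vector_mult_def
  by (intro continuous_intros)

lemma closeness_gap_nonneg:
  assumes "fst z \<in> prob_simplex" "snd z \<in> prob_simplex"
  shows "0 \<le> closeness_gap A z"
  using assms unfolding closeness_gap_def
  by (intro add_nonneg_nonneg sum_nonneg) (auto simp: prob_simplex_def)

lemma closeness_gap_eq_0D:
  fixes A :: "real ^ 'm ^ 'n"
  assumes uniq: "unique_optimal_solution A (xs, ys)"
    and z: "fst z \<in> prob_simplex" "snd z \<in> prob_simplex"
    and pos: "\<And>i. 0 < xs $ i \<Longrightarrow> 0 < fst z $ i" "\<And>j. 0 < ys $ j \<Longrightarrow> 0 < snd z $ j"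
    and gap: "closeness_gap A z = 0"
  shows "z = (xs, ys)"
proof -
  let ?u = "fst z \<bullet> (A *v snd z)"
  let ?f = "\<lambda>i. min (fst z $ i) \<bar>?u - (A *v snd z) $ i\<bar>"
  let ?g = "\<lambda>j. min (snd z $ j) \<bar>?u - (transpose A *v fst z) $ j\<bar>"
  have nonneg: "0 \<le> ?f i" "0 \<le> ?g j" for i j
    using z by (auto simp: prob_simplex_def)
  then have "0 \<le> sum ?f UNIV" "0 \<le> sum ?g UNIV" by (auto intro: sum_nonneg)
  moreover have "sum ?f UNIV + sum ?g UNIV = 0" using gap by (simp only: closeness_gap_def)
  ultimately have "sum ?f UNIV = 0" "sum ?g UNIV = 0" by (simp_all only: add_nonneg_eq_0_iff)
  then have f: "\<And>i. ?f i = 0" and g: "\<And>j. ?g j = 0"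
    using nonneg by (simp_all only: sum_nonneg_eq_0_iff finite UNIV_I ball_UNIV)
  have "(A *v snd z) $ i = ?u" if "0 < xs $ i" for i
    using pos(1)[OF that] f[of i] by linarith
  moreover have "(transpose A *v fst z) $ j = ?u" if "0 < ys $ j" for j
    using pos(2)[OF that] g[of j] by linarith
  ultimately have "(fst z, snd z) = (xs, ys)"
    by (intro unique_optimal_solution_if_equalizing[OF uniq z])
  then show ?thesis by simp
qed

section \<open>Bounds on the KL divergence\<close>

text \<open>This is ln t <= t - 1 at t = q / p. Summed over simplex points it gives Gibbs'
  inequality.\<close>

lemma KL_term_ge:
  fixes p q :: real
  assumes "0 \<le> p" "0 < q"
  shows "p - q \<le> p * ln (p / q)"
proof (cases "p = 0")
  case False
  with assms have "p * ln (q / p) \<le> p * (q / p - 1)"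
    by (intro mult_left_mono ln_le_minus_one) auto
  with False assms show ?thesis by (simp add: ln_div right_diff_distrib)
qed (use assms in auto)

lemma KL_sum_nonneg:
  fixes p q :: "real ^ 'k"
  assumes "p \<in> prob_simplex" "q \<in> prob_simplex" "\<And>i. 0 < q $ i"
  shows "0 \<le> (\<Sum>i\<in>UNIV. p $ i * ln (p $ i / q $ i))"
proof -
  have "(\<Sum>i\<in>UNIV. p $ i - q $ i) \<le> (\<Sum>i\<in>UNIV. p $ i * ln (p $ i / q $ i))"
    using assms by (intro sum_mono KL_term_ge) (auto simp: prob_simplex_def)
  then show ?thesis using assms by (simp add: prob_simplex_def sum_subtractf)
qed

text \<open>The remaining terms total at least -1, so the term at \<open>i\<close> is at most
  \<open>K + 1\<close>; solving for \<open>q $ i\<close> gives the bound. It depends on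
  \<open>q\<close> only through \<open>K\<close> and is positive wherever \<open>p $ i\<close>
  is.\<close>

lemma KL_sum_bounded_imp_coord_ge:
  fixes p q :: "real ^ 'k"
  assumes p: "p \<in> prob_simplex" and q: "q \<in> prob_simplex" "\<And>i. 0 < q $ i"
    and le: "(\<Sum>i\<in>UNIV. p $ i * ln (p $ i / q $ i)) \<le> K"
  shows "p $ i * exp (- (K + 1) / p $ i) \<le> q $ i"
proof (cases "p $ i = 0")
  case True
  \<comment> \<open>The factor \<open>p $ i\<close> makes the left side 0, whatever the division by
    zero inside \<open>exp\<close> returns.\<close>
  then show ?thesis using q(2)[of i] by simp
next
  case False
  with p have "0 < p $ i" by (simp add: prob_simplex_def less_le)
  have "(\<Sum>k\<in>UNIV - {i}. - q $ k) \<le> (\<Sum>k\<in>UNIV - {i}. p $ k * ln (p $ k / q $ k))"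
  proof (rule sum_mono)
    fix k
    have "0 \<le> p $ k" using p by (simp add: prob_simplex_def)
    then show "- q $ k \<le> p $ k * ln (p $ k / q $ k)"
      using KL_term_ge[of "p $ k" "q $ k"] q(2)[of k] by linarith
  qed
  moreover have "(\<Sum>k\<in>UNIV - {i}. q $ k) \<le> 1"
    using q(1) q(2)[of i] by (simp add: prob_simplex_def sum_diff1)
  moreover have "(\<Sum>k\<in>UNIV. p $ k * ln (p $ k / q $ k)) =
      p $ i * ln (p $ i / q $ i) + (\<Sum>k\<in>UNIV - {i}. p $ k * ln (p $ k / q $ k))"
    by (rule sum.remove) auto
  ultimately have "p $ i * ln (p $ i / q $ i) \<le> K + 1"
    using le by (simp add: sum_negf)
  then have "ln (p $ i / q $ i) \<le> (K + 1) / p $ i"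
    using \<open>0 < p $ i\<close> by (simp add: le_divide_eq mult.commute)
  then have "p $ i / q $ i \<le> exp ((K + 1) / p $ i)"
    using \<open>0 < p $ i\<close> q(2)[of i] by (simp add: ln_le_cancel_iff[symmetric] del: ln_le_cancel_iff)
  then show ?thesis
    using q(2)[of i] by (simp only: minus_divide_left[symmetric] exp_minus) (simp add: field_simps)
qed

section \<open>OMWU iterates\<close>

lemma exp_reweighting_in_prob_simplex:
  fixes x g :: "real ^ 'k"
  assumes x: "\<And>i. 0 < x $ i"
  defines "x' \<equiv> \<chi> i. x $ i * exp (g $ i) / (\<Sum>j\<in>UNIV. x $ j * exp (g $ j))"
  shows "x' \<in> prob_simplex" "0 < x' $ i"
proof -
  have s: "0 < (\<Sum>j\<in>UNIV. x $ j * exp (g $ j))"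
    using x by (intro sum_pos) auto
  with x show "0 < x' $ i" by (simp add: x'_def)
  show "x' \<in> prob_simplex"
    using x s by (auto simp: x'_def prob_simplex_def less_imp_le simp flip: sum_divide_distrib)
qed

lemma omwu_unif_in_prob_simplex:
  fixes A :: "real ^ 'm ^ 'n"
  shows "fst (omwu_unif \<eta> A t) \<in> prob_simplex" "snd (omwu_unif \<eta> A t) \<in> prob_simplex"
    "0 < fst (omwu_unif \<eta> A t) $ i" "0 < snd (omwu_unif \<eta> A t) $ j"
proof -
  define Q where "Q z \<longleftrightarrow> fst z \<in> prob_simplex \<and> snd z \<in> prob_simplex \<and>
    (\<forall>i. 0 < fst z $ i) \<and> (\<forall>j. 0 < snd z $ j)" for z :: "(real ^ 'n) \<times> (real ^ 'm)"
  have unif: "Q (uniform_vec, uniform_vec)"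
    by (simp add: Q_def uniform_vec_def prob_simplex_def)
  have step: "Q (omwu_step \<eta> A z z')" if "Q z" for z z'
  proof -
    obtain x y x' y' where z: "z = (x, y)" "z' = (x', y')" by fastforce
    have "\<And>i. 0 < x $ i" "\<And>j. 0 < y $ j" using that by (auto simp: Q_def z)
    note
      exp_reweighting_in_prob_simplex[OF this(1),
        of "\<chi> i. 2 * \<eta> * (A *v y) $ i - \<eta> * (A *v y') $ i"]
      exp_reweighting_in_prob_simplex[OF this(2),
        of "\<chi> i. - 2 * \<eta> * (transpose A *v x) $ i + \<eta> * (transpose A *v x') $ i"]
    then show ?thesis unfolding z omwu_step_def Q_def by simp
  qed
  \<comment> \<open>The recursion reaches two indices back, so the induction carries two consecutive
    iterates.\<close>
  have "Q (omwu_unif \<eta> A t) \<and> Q (omwu_unif \<eta> A (Suc t))"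
    by (induction t) (simp_all add: omwu_unif_def unif step)
  then show "fst (omwu_unif \<eta> A t) \<in> prob_simplex" "snd (omwu_unif \<eta> A t) \<in> prob_simplex"
    "0 < fst (omwu_unif \<eta> A t) $ i" "0 < snd (omwu_unif \<eta> A t) $ j"
    by (auto simp: Q_def)
qed

lemma tendsto_KL_sum:
  fixes p l :: "real ^ 'k" and q :: "'a \<Rightarrow> real ^ 'k"
  assumes "\<And>i. ((\<lambda>s. q s $ i) \<longlongrightarrow> l $ i) F" "\<And>i. l $ i \<noteq> 0"
  shows "((\<lambda>s. \<Sum>i\<in>UNIV. p $ i * ln (p $ i / q s $ i)) \<longlongrightarrow> (\<Sum>i\<in>UNIV. p $ i * ln (p $ i / l $ i))) F"
proof (rule tendsto_sum)
  fix i
  show "((\<lambda>s. p $ i * ln (p $ i / q s $ i)) \<longlongrightarrow> p $ i * ln (p $ i / l $ i)) F"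
    using assms by (cases "p $ i = 0") (auto intro!: tendsto_mult tendsto_ln tendsto_divide tendsto_const)
qed

lemma uniform_vec_exp_sum_neq_0: "(\<Sum>j\<in>UNIV. uniform_vec $ j * exp (f j)) \<noteq> 0"
  by (rule less_imp_neq[symmetric], rule sum_pos) (auto simp: uniform_vec_def)

text \<open>Iterate 2 is a single step from the uniform start, hence continuous in the stepsize even
  at 0. This bounds the divergence at time 2 uniformly for small \<open>\<eta>\<close>.\<close>

lemma tendsto_KL_div_omwu_unif_2:
  fixes A :: "real ^ 'm ^ 'n"
  shows "((\<lambda>\<eta>. KL_div z (omwu_unif \<eta> A 2)) \<longlongrightarrow> KL_div z (omwu_unif 0 A 2)) (at_right 0)"
proof -
  have two: "omwu_unif \<eta> A 2 = omwu_step \<eta> A (uniform_vec, uniform_vec) (uniform_vec, uniform_vec)" for \<eta>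
    by (simp add: omwu_unif_def numeral_2_eq_2)
  have "((\<lambda>\<eta>. fst (omwu_unif \<eta> A 2) $ i) \<longlongrightarrow> fst (omwu_unif 0 A 2) $ i) (at_right 0)" for i
    unfolding two omwu_step_def prod.case fst_conv snd_conv vec_lambda_beta
    by (intro tendsto_intros uniform_vec_exp_sum_neq_0)
  moreover have "((\<lambda>\<eta>. snd (omwu_unif \<eta> A 2) $ i) \<longlongrightarrow> snd (omwu_unif 0 A 2) $ i) (at_right 0)" for i
    unfolding two omwu_step_def prod.case fst_conv snd_conv vec_lambda_beta
    by (intro tendsto_intros uniform_vec_exp_sum_neq_0)
  ultimately show ?thesis
    unfolding KL_div_def using omwu_unif_in_prob_simplex(3,4)[of 0 A 2]
    by (intro tendsto_add tendsto_KL_sum) (auto simp: less_le)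
qed

section \<open>The stopping time\<close>

text \<open>A nonnegative sequence cannot drop by \<open>d\<close> forever, so the least index is
  attained; before it every step from \<open>s\<close> on is a decrease.\<close>

lemma first_insufficient_decrease:
  fixes D :: "nat \<Rightarrow> real" and s :: nat
  assumes nonneg: "\<And>t. 0 \<le> D t" and "0 < d"
  defines "T \<equiv> LEAST t. s \<le> t \<and> D t - d < D (t + 1)"
  shows "s \<le> T" "D T - d < D (T + 1)" "D T \<le> D s"
proof -
  have "\<exists>t. s \<le> t \<and> D t - d < D (t + 1)"
  proof (rule ccontr)
    assume "\<not> ?thesis"
    then have dec: "D (Suc t) \<le> D t - d" if "s \<le> t" for t
      using that by (auto simp: not_less)
    have le: "D (s + k) \<le> D s - real k * d" for k
    proof (induction k)
      case (Suc k)
      then show ?case using dec[of "s + k"] by (simp add: algebra_simps)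
    qed simp
    obtain k where "D s < real k * d" using reals_Archimedean3[OF \<open>0 < d\<close>] by blast
    with le[of k] nonneg[of "s + k"] show False by linarith
  qed
  then have "s \<le> T \<and> D T - d < D (T + 1)"
    unfolding T_def by (rule LeastI_ex)
  then show "s \<le> T" "D T - d < D (T + 1)" by auto
  have dec: "D (Suc t) \<le> D t" if "s \<le> t" "t < T" for t
    using not_less_Least[of t "\<lambda>t. s \<le> t \<and> D t - d < D (t + 1)"] that \<open>0 < d\<close>
    unfolding T_def by force
  have "s + k \<le> T \<Longrightarrow> D (s + k) \<le> D s" for k
  proof (induction k)
    case (Suc k)
    then show ?case using dec[of "s + k"] by simp
  qed simp
  from this[of "T - s"] \<open>s \<le> T\<close> show "D T \<le> D s" by simp
qed

section \<open>Convergence of the stopped iterates\<close>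

theorem theorem3p2:
  fixes A :: "real ^ 'm ^ 'n"
    and xs :: "real ^ 'n" and ys :: "real ^ 'm"
    and \<eta>0 c C :: real
  assumes "unique_optimal_solution A (xs, ys)"
    and "0 < \<eta>0" and "\<eta>0 < 1" and "0 < c" and "0 < C"
    and "\<And>\<eta> t. \<lbrakk>0 < \<eta>; \<eta> < \<eta>0; 2 \<le> t;
             \<not> alpha_close A (C * \<eta> powr (1 / 3)) (omwu_unif \<eta> A t)\<rbrakk> \<Longrightarrow>
           KL_div (xs, ys) (omwu_unif \<eta> A (t + 1))
             \<le> KL_div (xs, ys) (omwu_unif \<eta> A t) - c * \<eta> ^ 3"
  shows "((\<lambda>\<eta>. l1_norm ((xs, ys) - omwu_unif \<eta> A (stop_time c A (xs, ys) \<eta>)))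
           \<longlongrightarrow> 0) (at_right 0)"
proof -
  define D where "D \<eta> t = KL_div (xs, ys) (omwu_unif \<eta> A t)" for \<eta> t
  define T where "T \<eta> = stop_time c A (xs, ys) \<eta>" for \<eta>
  define z where "z \<eta> = omwu_unif \<eta> A (T \<eta>)" for \<eta>
  \<comment> \<open>\<open>D 0 2\<close> is the limit of \<open>D \<eta> 2\<close> as
    \<open>\<eta>\<close> tends to 0; adding 1 gives a strict upper bound for all small
    \<open>\<eta>\<close>.\<close>
  define K where "K = D 0 2 + 1"
  \<comment> \<open>A compact set, independent of \<open>\<eta>\<close>, that eventually contains
    the stopped iterates. Its lower bounds are positive on the supports of \<open>xs\<close> and
    \<open>ys\<close> and 0 elsewhere.\<close>
  define W where "W = {z. fst z \<in> prob_simplex \<and> snd z \<in> prob_simplex \<and>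
    (\<forall>i. xs $ i * exp (- (K + 1) / xs $ i) \<le> fst z $ i) \<and>
    (\<forall>j. ys $ j * exp (- (K + 1) / ys $ j) \<le> snd z $ j)}"
  have simplex: "xs \<in> prob_simplex" "ys \<in> prob_simplex"
    using assms(1) by (auto simp: unique_optimal_solution_def optimal_solution_iff)
  have KL_nonneg:
    "0 \<le> (\<Sum>i\<in>UNIV. xs $ i * ln (xs $ i / fst (omwu_unif \<eta> A t) $ i))"
    "0 \<le> (\<Sum>i\<in>UNIV. ys $ i * ln (ys $ i / snd (omwu_unif \<eta> A t) $ i))" for \<eta> t
    by (intro KL_sum_nonneg simplex omwu_unif_in_prob_simplex)+
  then have D_nonneg: "0 \<le> D \<eta> t" for \<eta> t
    by (simp add: D_def KL_div_def)
  have T: "2 \<le> T \<eta>" "D \<eta> (T \<eta>) - c * \<eta> ^ 3 < D \<eta> (T \<eta> + 1)"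
    "D \<eta> (T \<eta>) \<le> D \<eta> 2" if "0 < \<eta>" for \<eta>
    using first_insufficient_decrease[of "D \<eta>" "c * \<eta> ^ 3" 2] D_nonneg that \<open>0 < c\<close>
    by (auto simp: T_def stop_time_def D_def)
  have small: "\<forall>\<^sub>F \<eta> in at_right 0. \<eta> \<in> {0<..<\<eta>0}"
    using \<open>0 < \<eta>0\<close> by (rule eventually_at_right_real)
  have in_W: "\<forall>\<^sub>F \<eta> in at_right 0. z \<eta> \<in> W"
  proof -
    have "\<forall>\<^sub>F \<eta> in at_right 0. D \<eta> 2 < K"
      using tendsto_KL_div_omwu_unif_2 unfolding D_def K_def by (rule order_tendstoD(2)) simp
    with small show ?thesis
    proof eventually_elim
      case (elim \<eta>)
      with T(3)[of \<eta>] have "D \<eta> (T \<eta>) \<le> K" by simp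
      with KL_nonneg[of \<eta> "T \<eta>"] have
        "(\<Sum>i\<in>UNIV. xs $ i * ln (xs $ i / fst (z \<eta>) $ i)) \<le> K"
        "(\<Sum>i\<in>UNIV. ys $ i * ln (ys $ i / snd (z \<eta>) $ i)) \<le> K"
        by (simp_all add: D_def KL_div_def z_def)
      then show ?case
        unfolding W_def mem_Collect_eq z_def
        by (intro conjI allI KL_sum_bounded_imp_coord_ge simplex omwu_unif_in_prob_simplex)
    qed
  qed
  have close: "\<forall>\<^sub>F \<eta> in at_right 0. alpha_close A (C * \<eta> powr (1 / 3)) (z \<eta>)"
    using small
  proof eventually_elim
    case (elim \<eta>)
    \<comment> \<open>Contrapositive of the decrease hypothesis: at \<open>T \<eta>\<close> the
      decrease fails, so the iterate is close.\<close>
    then show ?case using assms(6)[of \<eta> "T \<eta>"] T[of \<eta>] by (force simp: D_def z_def)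
  qed
  have gap_pos: "0 < closeness_gap A z" if "z \<in> W" "z \<noteq> (xs, ys)" for z
  proof -
    have "0 < fst z $ i" if "0 < xs $ i" for i
      using \<open>z \<in> W\<close> that by (auto simp: W_def intro: less_le_trans[rotated])
    moreover have "0 < snd z $ j" if "0 < ys $ j" for j
      using \<open>z \<in> W\<close> that by (auto simp: W_def intro: less_le_trans[rotated])
    ultimately have "closeness_gap A z \<noteq> 0"
      using closeness_gap_eq_0D[OF assms(1), of z] that unfolding W_def by blast
    with that(1) closeness_gap_nonneg[of z A] show ?thesis by (auto simp: W_def)
  qed
  have compact_W: "compact W"
  proof -
    have "W = (prob_simplex \<times> prob_simplex) \<inter>
      {z. (\<forall>i. xs $ i * exp (- (K + 1) / xs $ i) \<le> fst z $ i) \<and>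
        (\<forall>j. ys $ j * exp (- (K + 1) / ys $ j) \<le> snd z $ j)}"
      by (auto simp: W_def)
    moreover have "closed {z :: (real ^ 'n) \<times> (real ^ 'm).
        (\<forall>i. xs $ i * exp (- (K + 1) / xs $ i) \<le> fst z $ i) \<and>
        (\<forall>j. ys $ j * exp (- (K + 1) / ys $ j) \<le> snd z $ j)}"
      by (intro closed_Collect_conj closed_Collect_all closed_Collect_le continuous_intros)
    ultimately show ?thesis
      by (simp add: compact_Int_closed compact_Times compact_prob_simplex)
  qed
  have l1_nonneg: "0 \<le> l1_norm w" for w :: "(real ^ 'n) \<times> (real ^ 'm)"
    by (simp add: l1_norm_def sum_nonneg)
  show ?thesis
    unfolding T_def[symmetric] z_def[symmetric]
  proof (rule tendstoI)
    fix e :: real assume "0 < e"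
    \<comment> \<open>Compactness enters through a minimum rather than through limit points: on
      \<open>V\<close> the gap has a positive lower bound \<open>\<mu>\<close>, while the gap of
      \<open>z \<eta>\<close> eventually falls below \<open>\<mu>\<close>, so
      \<open>z \<eta>\<close> leaves \<open>V\<close>.\<close>
    define V where "V = W \<inter> {w. e \<le> l1_norm ((xs, ys) - w)}"
    have "closed {w. e \<le> l1_norm ((xs, ys) - w)}"
      unfolding l1_norm_def by (intro closed_Collect_le continuous_intros)
    then have "compact V" unfolding V_def using compact_W by (rule compact_Int_closed[rotated])
    have "\<exists>\<mu>>0. \<forall>w\<in>V. \<mu> \<le> closeness_gap A w"
    proof (cases "V = {}")
      case False
      obtain w where w: "w \<in> V" "\<forall>w'\<in>V. closeness_gap A w \<le> closeness_gap A w'"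
        using continuous_attains_inf[OF \<open>compact V\<close> False continuous_on_closeness_gap] by blast
      have "w \<noteq> (xs, ys)"
        using w(1) \<open>0 < e\<close> by (auto simp: V_def l1_norm_def)
      then have "0 < closeness_gap A w"
        using gap_pos w(1) by (simp add: V_def)
      with w(2) show ?thesis by blast
    qed (auto intro: exI[of _ 1])
    then obtain \<mu> where \<mu>: "0 < \<mu>" "\<And>w. w \<in> V \<Longrightarrow> \<mu> \<le> closeness_gap A w"
      by blast
    have "((\<lambda>\<eta>. \<eta> powr (1 / 3)) \<longlongrightarrow> (0::real)) (at_right 0)"
      by (rule tendsto_zero_powrI[where b = "1 / 3"])
        (auto intro!: tendsto_intros simp: eventually_at_filter)
    then have "((\<lambda>\<eta>. (real CARD('n) + real CARD('m)) * (C * \<eta> powr (1 / 3))) \<longlongrightarrow>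
        (real CARD('n) + real CARD('m)) * (C * 0)) (at_right 0)"
      by (intro tendsto_intros)
    then have "\<forall>\<^sub>F \<eta> in at_right 0. (real CARD('n) + real CARD('m)) * (C * \<eta> powr (1 / 3)) < \<mu>"
      using \<mu>(1) by (intro order_tendstoD(2)) auto
    with in_W close show "\<forall>\<^sub>F \<eta> in at_right 0. dist (l1_norm ((xs, ys) - z \<eta>)) 0 < e"
    proof eventually_elim
      case (elim \<eta>)
      with closeness_gap_le[OF elim(2)] have "z \<eta> \<notin> V" using \<mu>(2)[of "z \<eta>"] by linarith
      with elim(1) l1_nonneg show ?case by (simp add: V_def)
    qed
  qed
qed

end
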